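(* Let $V$ be an $n$-dimensional complex vector space and $P\subset V\oplus V$ a linear relation with $\dim P=n$. Then: (a) $\lambda^m(P)\neq0$ if and only if $\dim\mathrm{Indef}\,P\le m\le\dim\mathrm{Im}\,P$. (b) If $m=\dim\mathrm{Indef}\,P$, then $\mathrm{rk}\,\lambda^m(P)=1$, and $\lambda^m(P)=\lambda^m(Q)$ (up to a nonzero factor) for any linear relation $Q$ with $\dim Q=n$, $\mathrm{Indef}\,Q=\mathrm{Indef}\,P$, $\mathrm{Dom}\,Q=\mathrm{Dom}\,P$; in particular one may take $Q=\mathrm{Dom}\,P\oplus\mathrm{Indef}\,P$. (c) If $m=\dim\mathrm{Im}\,P$, then $\mathrm{rk}\,\lambda^m(P)=1$, and $\lambda^m(P)=\lambda^m(R)$ (up to a nonzero factor) for any linear relation $R$ with $\dim R=n$, $\mathrm{Im}\,R=\mathrm{Im}\,P$, $\mathrm{Ker}\,R=\mathrm{Ker}\,P$; in particular one may take $R=\mathrm{Ker}\,P\oplus\mathrm{Im}\,P$.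
   Context: A linear relation $P:V\rightrightarrows V$ is a linear subspace $P\subset V\oplus V$. $\mathrm{Ker}\,P=\{v: v\oplus0\in P\}$, $\mathrm{Dom}\,P$ is the projection of $P$ onto the first summand, $\mathrm{Im}\,P$ the projection onto the second summand, $\mathrm{Indef}\,P=\{w:0\oplus w\in P\}$. If $\dim P=n$, there exist bases $f_1,\dots,f_a,g_1,\dots,g_b,h_1,\dots,h_c$ and $F_1,\dots,F_a,G_1,\dots,G_b,H_1,\dots,H_c$ of $V$ such that $P$ is spanned by the vectors $0\oplus F_i$, $g_j\oplus G_j$, $h_k\oplus0$. The operator $\lambda(P):\Lambda V\to\Lambda V$ sends $f_1\wedge\dots\wedge f_a\wedge g_{i_1}\wedge\dots\wedge g_{i_s}$ (for $i_1<\dots<i_s$) to $F_1\wedge\dots\wedge F_a\wedge G_{i_1}\wedge\dots\wedge G_{i_s}$ and annihilates all other wedge monomials in the basis $f,g,h$; it depends on the choice of bases only up to a nonzero scalar factor. $\lambda^m(P)$ is the restriction of $\lambda(P)$ to $\Lambda^mV\to\Lambda^mV$. Equalities between such operators are understood up to a nonzero scalar factor. *)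

theory Defs
  imports "HOL-Analysis.Analysis"
begin

text \<open>The ambient space is V = complex^'n (dimension n = CARD('n)); the index type
 carries a linear order, used only to fix the sign convention of wedge monomials.
 The exterior algebra \<Lambda>V is represented as complex^('n set): the coordinate at a set
 S of indices is the coefficient of the basis monomial e_S (indices in increasing order).\<close>

interpretation vpair: vector_space_prod
  "(*s) :: 'a::field \<Rightarrow> 'a^'n \<Rightarrow> 'a^'n" "(*s) :: 'a::field \<Rightarrow> 'a^'m \<Rightarrow> 'a^'m"
  by unfold_locales

type_synonym 'n vsp = "complex ^ 'n"
type_synonym 'n ext = "complex ^ ('n set)"

text \<open>Linear relation P : V \<rightrightarrows> V, i.e. a linear subspace of V \<oplus> V.\<close>
definition linrel :: "('n::finite vsp \<times> 'n vsp) set \<Rightarrow> bool" where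
  "linrel P \<longleftrightarrow> vpair.p.subspace P"

definition rdim :: "('n::finite vsp \<times> 'n vsp) set \<Rightarrow> nat" where
  "rdim P = vpair.p.dim P"

definition rKer :: "('n::finite vsp \<times> 'n vsp) set \<Rightarrow> 'n vsp set" where
  "rKer P = {v. (v, 0) \<in> P}"
definition rDom :: "('n::finite vsp \<times> 'n vsp) set \<Rightarrow> 'n vsp set" where
  "rDom P = fst ` P"
definition rIm :: "('n::finite vsp \<times> 'n vsp) set \<Rightarrow> 'n vsp set" where
  "rIm P = snd ` P"
definition rIndef :: "('n::finite vsp \<times> 'n vsp) set \<Rightarrow> 'n vsp set" where
  "rIndef P = {w. (0, w) \<in> P}"

text \<open>Wedge product v_0 \<and> ... \<and> v_(k-1) of a list of vectors, as an element of \<Lambda>V: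
 its coefficient at S is the k x k minor on the columns of S (in increasing order).\<close>
definition wedge :: "('n::{finite,linorder}) vsp list \<Rightarrow> 'n ext" where
  "wedge vs = (\<chi> S. if card S = length vs then
      (\<Sum>p | p permutes {..<length vs}. of_int (sign p) *
         (\<Prod>i<length vs. (vs ! i) $ (sorted_list_of_set S ! p i)))
      else 0)"

text \<open>Homogeneous component \<Lambda>^m V.\<close>
definition extpow :: "nat \<Rightarrow> ('n::finite) ext set" where
  "extpow m = {x. \<forall>S. card S \<noteq> m \<longrightarrow> x $ S = 0}"

definition is_basis_list :: "('n::finite) vsp list \<Rightarrow> bool" where
  "is_basis_list bs \<longleftrightarrow> distinct bs \<and> vec.independent (set bs) \<and> vec.span (set bs) = UNIV"

text \<open>L is an admissible choice of the operator \<lambda>(P) : \<Lambda>V \<rightarrow> \<Lambda>V: there are bases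
 f@g@h and F@G@H of V with P spanned by 0\<oplus>F_i, g_j\<oplus>G_j, h_k\<oplus>0, and L is the linear
 map sending the monomial over f_1..f_a,g_{i_1}..g_{i_s} to F_1..F_a,G_{i_1}..G_{i_s}
 and annihilating all other monomials in the basis f,g,h.  (\<lambda>(P) is only defined up
 to a nonzero factor; the predicate describes all admissible representatives.)\<close>
definition is_lambda :: "('n::{finite,linorder} vsp \<times> 'n vsp) set \<Rightarrow> ('n ext \<Rightarrow> 'n ext) \<Rightarrow> bool" where
  "is_lambda P L \<longleftrightarrow> (\<exists>f g h F G H.
     length F = length f \<and> length G = length g \<and> length H = length h \<and>
     is_basis_list (f @ g @ h) \<and> is_basis_list (F @ G @ H) \<and>
     P = vpair.p.span ((\<lambda>v. (0, v)) ` set F \<union> set (zip g G) \<union> (\<lambda>v. (v, 0)) ` set h) \<and>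
     Vector_Spaces.linear (*s) (*s) L \<and>
     (\<forall>T \<subseteq> {..<length (f @ g @ h)}.
        L (wedge (map (\<lambda>i. (f @ g @ h) ! i) (sorted_list_of_set T))) =
          (if {..<length f} \<subseteq> T \<and> T \<subseteq> {..<length f + length g}
           then wedge (map (\<lambda>i. (F @ G @ H) ! i) (sorted_list_of_set T)) else 0)))"

text \<open>\<lambda>^m(L) \<noteq> 0, rank of \<lambda>^m, and equality up to a nonzero scalar of the restrictions to \<Lambda>^m.\<close>
definition deg_nonzero :: "nat \<Rightarrow> ('n::finite ext \<Rightarrow> 'n ext) \<Rightarrow> bool" where
  "deg_nonzero m L \<longleftrightarrow> (\<exists>x \<in> extpow m. L x \<noteq> 0)"

definition deg_rank :: "nat \<Rightarrow> ('n::finite ext \<Rightarrow> 'n ext) \<Rightarrow> nat" where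
  "deg_rank m L = vec.dim (L ` extpow m)"

definition deg_eq_upto :: "nat \<Rightarrow> ('n::finite ext \<Rightarrow> 'n ext) \<Rightarrow> ('n ext \<Rightarrow> 'n ext) \<Rightarrow> bool" where
  "deg_eq_upto m L1 L2 \<longleftrightarrow> (\<exists>c::complex. c \<noteq> 0 \<and> (\<forall>x \<in> extpow m. L1 x = c *s L2 x))"

end

theory Submission
  imports Defs "HOL-Combinatorics.List_Permutation"
begin

(* Choose bases f,g,h and F,G,H adapted to P. Then Indef P, Im P, Dom P and Ker P are spanned by
   F, F@G, g@h and h respectively, so dim Indef P = |f| and dim Im P = |f| + |g|. On the degree-m
   monomials of the basis f,g,h, lambda(P) is nonzero exactly on those containing all of f and
   none of h, which exist iff |f| <= m <= |f| + |g|. In the two extreme degrees k only the head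
   monomial of the first k basis vectors survives, so lambda^k(P) has rank one. If a second
   relation has the same head space (Indef, resp. Im) and the same tail space (Dom, resp. Ker),
   the head wedges of the two target bases are proportional, and its lambda^k kills every other
   degree-k monomial of the basis of P: such a monomial contains a tail vector, which is a
   combination of tail vectors of the second basis. Both restrictions to degree k are therefore
   determined by a single value and agree up to a nonzero factor. *)

section \<open>Wedge products of vectors\<close>

lemma wedge_component:
  "wedge vs $ S = (if card S = length vs then
      (\<Sum>p | p permutes {..<length vs}. of_int (sign p) *
         (\<Prod>i<length vs. (vs ! i) $ (sorted_list_of_set S ! p i)))
      else 0)"
  unfolding wedge_def by simp

lemma wedge_in_extpow: "wedge vs \<in> extpow (length vs)"
  unfolding extpow_def by (simp add: wedge_component)

lemma wedge_permute:
  assumes \<sigma>: "\<sigma> permutes {..<length vs}"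
  shows "wedge (map (\<lambda>i. vs ! \<sigma> i) [0..<length vs]) = of_int (sign \<sigma>) *s wedge vs"
proof (rule vec_eq_iff[THEN iffD2], intro allI)
  fix S :: "'a set"
  let ?m = "length vs" and ?s = "sorted_list_of_set S"
  show "wedge (map (\<lambda>i. vs ! \<sigma> i) [0..<?m]) $ S = (of_int (sign \<sigma>) *s wedge vs) $ S"
  proof (cases "card S = ?m")
    case False
    then show ?thesis by (simp add: wedge_component)
  next
    case True
    have "wedge (map (\<lambda>i. vs ! \<sigma> i) [0..<?m]) $ S
       = (\<Sum>p | p permutes {..<?m}. of_int (sign p) * (\<Prod>i<?m. vs ! \<sigma> i $ (?s ! p i)))"
      using True by (simp add: wedge_component)
    also have "\<dots> = (\<Sum>p | p permutes {..<?m}.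
        of_int (sign (p \<circ> \<sigma>)) * (\<Prod>i<?m. vs ! \<sigma> i $ (?s ! (p \<circ> \<sigma>) i)))"
      by (rule sum_permutations_compose_right[OF \<sigma>])
    also have "\<dots> = (\<Sum>p | p permutes {..<?m}.
        of_int (sign \<sigma>) * (of_int (sign p) * (\<Prod>i<?m. vs ! i $ (?s ! p i))))"
    proof (rule sum.cong[OF refl])
      fix p assume "p \<in> {p. p permutes {..<?m}}"
      then have "sign (p \<circ> \<sigma>) = sign p * sign \<sigma>"
        using \<sigma> by (simp add: sign_compose permutes_imp_permutation[OF finite_lessThan])
      moreover have "(\<Prod>i<?m. vs ! \<sigma> i $ (?s ! (p \<circ> \<sigma>) i)) = (\<Prod>i<?m. vs ! i $ (?s ! p i))"
        using prod.permute[OF \<sigma>, of "\<lambda>i. vs ! i $ (?s ! p i)"] by (simp add: o_def)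
      ultimately show "of_int (sign (p \<circ> \<sigma>)) * (\<Prod>i<?m. vs ! \<sigma> i $ (?s ! (p \<circ> \<sigma>) i)) =
          of_int (sign \<sigma>) * (of_int (sign p) * (\<Prod>i<?m. vs ! i $ (?s ! p i)))"
        by simp
    qed
    also have "\<dots> = (of_int (sign \<sigma>) *s wedge vs) $ S"
      using True by (simp add: wedge_component sum_distrib_left)
    finally show ?thesis .
  qed
qed

lemma wedge_repeated_eq_0:
  assumes "a < length vs" "c < length vs" "a \<noteq> c" "vs ! a = vs ! c"
  shows "wedge vs = 0"
proof -
  let ?t = "Transposition.transpose a c"
  have "?t permutes {..<length vs}"
    using assms by (intro permutes_swap_id) auto
  moreover have "map (\<lambda>i. vs ! ?t i) [0..<length vs] = vs"
    using assms by (intro nth_equalityI) (auto simp: Transposition.transpose_def)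
  ultimately have "wedge vs = - wedge vs"
    using wedge_permute[of ?t vs] assms by (simp add: sign_swap_id)
  then show ?thesis
    by (simp add: vec_eq_iff)
qed

lemma wedge_sum_expand:
  fixes b :: "nat \<Rightarrow> 'n::{finite,linorder} vsp"
  assumes "length vs = m" and fin: "\<And>i. i < m \<Longrightarrow> finite (J i)"
    and vs: "\<And>i. i < m \<Longrightarrow> vs ! i = (\<Sum>j\<in>J i. C i j *s b j)"
  shows "wedge vs = (\<Sum>\<phi>\<in>PiE {..<m} J. (\<Prod>i<m. C i (\<phi> i)) *s wedge (map (\<lambda>i. b (\<phi> i)) [0..<m]))"
proof (rule vec_eq_iff[THEN iffD2], intro allI)
  fix S :: "'n set"
  let ?s = "sorted_list_of_set S" and ?P = "{p. p permutes {..<m}}" and ?F = "PiE {..<m} J"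
  let ?w = "\<lambda>\<phi> p. of_int (sign p) * (\<Prod>i<m. b (\<phi> i) $ (?s ! p i))"
  show "wedge vs $ S = (\<Sum>\<phi>\<in>?F. (\<Prod>i<m. C i (\<phi> i)) *s wedge (map (\<lambda>i. b (\<phi> i)) [0..<m])) $ S"
  proof (cases "card S = m")
    case False
    then show ?thesis using assms(1) by (simp add: wedge_component sum_component)
  next
    case True
    have "wedge vs $ S = (\<Sum>p\<in>?P. of_int (sign p) * (\<Prod>i<m. \<Sum>j\<in>J i. C i j * b j $ (?s ! p i)))"
      using True assms(1) vs by (simp add: wedge_component sum_component)
    also have "\<dots> = (\<Sum>p\<in>?P. of_int (sign p) * (\<Sum>\<phi>\<in>?F. \<Prod>i<m. C i (\<phi> i) * b (\<phi> i) $ (?s ! p i)))"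
      using fin by (intro sum.cong refl arg_cong2[where f="(*)"] prod_sum_PiE) auto
    also have "\<dots> = (\<Sum>\<phi>\<in>?F. \<Sum>p\<in>?P. (\<Prod>i<m. C i (\<phi> i)) * ?w \<phi> p)"
      by (subst sum.swap) (simp add: sum_distrib_left prod.distrib mult_ac)
    also have "\<dots> = (\<Sum>\<phi>\<in>?F. (\<Prod>i<m. C i (\<phi> i)) * wedge (map (\<lambda>i. b (\<phi> i)) [0..<m]) $ S)"
      using True by (simp add: wedge_component sum_distrib_left)
    finally show ?thesis
      by (simp add: sum_component)
  qed
qed

lemma span_image_coeffs:
  fixes b :: "nat \<Rightarrow> 'n::finite vsp"
  assumes fin: "finite J" and x: "x \<in> vec.span (b ` J)"
  shows "\<exists>c. x = (\<Sum>j\<in>J. c j *s b j)"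
  using x
proof (induction rule: vec.span_induct_alt)
  case base
  show ?case by (rule exI[of _ "\<lambda>_. 0"]) simp
next
  case (step c0 x y)
  then obtain c where c: "y = (\<Sum>j\<in>J. c j *s b j)" by blast
  from step obtain j0 where j0: "j0 \<in> J" "x = b j0" by blast
  have "(\<Sum>j\<in>J. (c j + (if j = j0 then c0 else 0)) *s b j) = y + (\<Sum>j\<in>J. (if j = j0 then c0 else 0) *s b j)"
    by (simp add: c vec.scale_left_distrib sum.distrib)
  also have "(\<Sum>j\<in>J. (if j = j0 then c0 else 0) *s b j) = (\<Sum>j\<in>J. if j = j0 then c0 *s b j else 0)"
    by (intro sum.cong) auto
  also have "\<dots> = c0 *s x" using fin j0 by simp
  finally show ?case by (metis add.commute)
qed

definition basis_wedge :: "'n::{finite,linorder} vsp list \<Rightarrow> nat set \<Rightarrow> 'n ext" where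
  "basis_wedge b T = wedge (map ((!) b) (sorted_list_of_set T))"

lemma basis_wedge_lessThan:
  assumes "k \<le> length b"
  shows "basis_wedge b {..<k} = wedge (take k b)"
proof -
  have "sorted_list_of_set {..<k} = [0..<k]" by (simp add: lessThan_atLeast0)
  then show ?thesis using assms unfolding basis_wedge_def by (auto intro!: arg_cong[where f=wedge] nth_equalityI)
qed

lemma wedge_reorder:
  assumes inj: "inj_on \<phi> {..<m}"
  shows "\<exists>\<sigma>::nat \<Rightarrow> nat.
    wedge (map (\<lambda>i. b ! \<phi> i) [0..<m]) = of_int (sign \<sigma>) *s basis_wedge b (\<phi> ` {..<m})"
proof -
  let ?t = "sorted_list_of_set (\<phi> ` {..<m})"
  have lt: "length ?t = m" using inj by (simp add: card_image)
  let ?xs = "map \<phi> [0..<m]"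
  have "distinct ?xs" using inj by (simp add: distinct_map atLeast0LessThan)
  then have "mset ?xs = mset ?t"
    by (subst set_eq_iff_mset_eq_distinct[symmetric]) auto
  then obtain f where f_bij: "bij_betw f {..<length ?xs} {..<length ?t}"
    and f_nth: "\<forall>i<length ?xs. ?xs ! i = ?t ! f i"
    using permutation_Ex_bij by blast
  have f: "bij_betw f {..<m} {..<m}" using f_bij lt by simp
  define \<sigma> where "\<sigma> i = (if i < m then f i else i)" for i
  let ?v = "map ((!) b) ?t"
  have "bij_betw \<sigma> {..<m} {..<m}"
    using f bij_betw_cong[of "{..<m}" \<sigma> f] by (simp add: \<sigma>_def)
  then have \<sigma>: "\<sigma> permutes {..<length ?v}"
    using lt by (intro bij_imp_permutes) (auto simp: \<sigma>_def)
  have "map (\<lambda>i. ?v ! \<sigma> i) [0..<length ?v] = map (\<lambda>i. b ! \<phi> i) [0..<m]"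
  proof (rule nth_equalityI)
    fix i assume "i < length (map (\<lambda>i. ?v ! \<sigma> i) [0..<length ?v])"
    then have "i < m" using lt by simp
    moreover have "f i < m" using bij_betw_apply[OF f] \<open>i < m\<close> by blast
    moreover have "?t ! f i = \<phi> i" using f_nth[rule_format, of i] \<open>i < m\<close> by simp
    ultimately show "map (\<lambda>i. ?v ! \<sigma> i) [0..<length ?v] ! i = map (\<lambda>i. b ! \<phi> i) [0..<m] ! i"
      using lt by (simp add: \<sigma>_def)
  qed (use lt in simp)
  then have "wedge (map (\<lambda>i. b ! \<phi> i) [0..<m]) = of_int (sign \<sigma>) *s wedge ?v"
    using wedge_permute[OF \<sigma>] by simp
  then show ?thesis
    unfolding basis_wedge_def by blast
qed

lemma wedge_in_span_basis_wedges:
  assumes len: "length vs = m" and fin: "\<And>i. i < m \<Longrightarrow> finite (J i)"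
    and vs: "\<And>i. i < m \<Longrightarrow> vs ! i \<in> vec.span ((!) b ` J i)"
  shows "wedge vs \<in> vec.span {basis_wedge b (\<phi> ` {..<m}) | \<phi>. \<phi> \<in> PiE {..<m} J \<and> inj_on \<phi> {..<m}}"
    (is "_ \<in> vec.span ?W")
proof -
  have coeffs: "\<forall>i\<in>{..<m}. \<exists>c. vs ! i = (\<Sum>j\<in>J i. c j *s b ! j)"
    using span_image_coeffs[OF fin vs] by blast
  obtain C where "\<forall>i\<in>{..<m}. vs ! i = (\<Sum>j\<in>J i. C i j *s b ! j)"
    using bchoice[OF coeffs] by blast
  then have "wedge vs =
      (\<Sum>\<phi>\<in>PiE {..<m} J. (\<Prod>i<m. C i (\<phi> i)) *s wedge (map (\<lambda>i. b ! \<phi> i) [0..<m]))"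
    by (intro wedge_sum_expand[OF len]) (use fin in auto)
  also have "\<dots> \<in> vec.span ?W"
  proof (intro vec.span_sum vec.span_scale)
    fix \<phi> assume \<phi>: "\<phi> \<in> PiE {..<m} J"
    show "wedge (map (\<lambda>i. b ! \<phi> i) [0..<m]) \<in> vec.span ?W"
    proof (cases "inj_on \<phi> {..<m}")
      case True
      then obtain \<sigma> :: "nat \<Rightarrow> nat"
        where "wedge (map (\<lambda>i. b ! \<phi> i) [0..<m]) = of_int (sign \<sigma>) *s basis_wedge b (\<phi> ` {..<m})"
        using wedge_reorder by blast
      moreover have "basis_wedge b (\<phi> ` {..<m}) \<in> ?W"
        using \<phi> True by blast
      ultimately show ?thesis by (simp add: vec.span_scale vec.span_base)
    next
      case False
      then obtain a c where "a < m" "c < m" "a \<noteq> c" "\<phi> a = \<phi> c"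
        unfolding inj_on_def by blast
      then have "wedge (map (\<lambda>i. b ! \<phi> i) [0..<m]) = 0"
        by (intro wedge_repeated_eq_0[of a _ c]) simp_all
      then show ?thesis by (simp add: vec.span_zero)
    qed
  qed
  finally show ?thesis .
qed

section \<open>Exterior powers are spanned freely by basis monomials\<close>

lemma sorted_list_of_set_permute_eq:
  fixes S S' :: "'a::{finite,linorder} set"
  assumes p: "p permutes {..<card S}" and card: "card S' = card S"
    and eq: "\<forall>i<card S. sorted_list_of_set S' ! p i = sorted_list_of_set S ! i"
  shows "S' = S \<and> p = id"
proof
  let ?s = "sorted_list_of_set S" and ?m = "card S"
  have "S \<subseteq> S'"
  proof
    fix x assume "x \<in> S"
    then obtain i where "i < ?m" "x = ?s ! i"
      by (metis finite in_set_conv_nth length_sorted_list_of_set set_sorted_list_of_set)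
    moreover have "p i < card S'" using p card \<open>i < ?m\<close> by (auto dest: permutes_in_image)
    ultimately show "x \<in> S'"
      using eq by (metis finite nth_mem set_sorted_list_of_set length_sorted_list_of_set)
  qed
  then show "S' = S" using card by (metis card_subset_eq finite)
  show "p = id"
  proof
    fix i show "p i = id i"
    proof (cases "i < ?m")
      case True
      then have "p i < ?m" using p by (auto dest: permutes_in_image)
      moreover have "?s ! p i = ?s ! i" using eq True \<open>S' = S\<close> by simp
      ultimately show ?thesis
        using True by (simp add: nth_eq_iff_index_eq)
    next
      case False
      then show ?thesis using p by (simp add: permutes_not_in)
    qed
  qed
qed

lemma wedge_axis: "wedge (map (\<lambda>s. axis s 1) (sorted_list_of_set S)) = axis S (1::complex)"
proof (rule vec_eq_iff[THEN iffD2], intro allI)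
  fix S' :: "'a set"
  let ?s = "sorted_list_of_set S" and ?s' = "sorted_list_of_set S'" and ?m = "card S"
  have "wedge (map (\<lambda>s. axis s 1) ?s) $ S' =
      (\<Sum>p | p permutes {..<?m}. if S' = S \<and> p = id then 1 else 0)"
  proof (cases "card S' = ?m")
    case True
    have prod: "(\<Prod>i<?m. axis (?s ! i) (1::complex) $ (?s' ! p i)) = (if S' = S \<and> p = id then 1 else 0)"
      if "p permutes {..<?m}" for p
      using sorted_list_of_set_permute_eq[OF that True] by (auto simp: axis_def prod_zero_iff)
    have "wedge (map (\<lambda>s. axis s 1) ?s) $ S' =
        (\<Sum>p | p permutes {..<?m}. of_int (sign p) * (\<Prod>i<?m. axis (?s ! i) 1 $ (?s' ! p i)))"
      using True by (simp add: wedge_component)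
    also have "\<dots> = (\<Sum>p | p permutes {..<?m}. if S' = S \<and> p = id then 1 else 0)"
      by (rule sum.cong) (auto simp: prod sign_id)
    finally show ?thesis .
  next
    case False
    then have "S' \<noteq> S" by auto
    with False show ?thesis by (simp add: wedge_component)
  qed
  also have "\<dots> = axis S 1 $ S'"
    by (auto simp: axis_def permutes_id finite_permutations)
  finally show "wedge (map (\<lambda>s. axis s 1) ?s) $ S' = axis S 1 $ S'" .
qed

lemma extpow_subspace: "vec.subspace (extpow m)"
  unfolding vec.subspace_def extpow_def by auto

lemma extpow_eq_span_axis: "extpow m = vec.span {axis S (1::complex) | S. card S = m}"
proof
  show "extpow m \<subseteq> vec.span {axis S 1 | S. card S = m}"
  proof
    fix x assume x: "x \<in> extpow m"
    have "x = (\<Sum>S\<in>{S. card S = m}. x $ S *s axis S 1)"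
      using x by (auto simp: vec_eq_iff sum_component axis_def extpow_def if_distrib sum.delta cong: if_cong)
    also have "\<dots> \<in> vec.span {axis S 1 | S. card S = m}"
      by (intro vec.span_sum vec.span_scale vec.span_base) auto
    finally show "x \<in> vec.span {axis S 1 | S. card S = m}" .
  qed
  show "vec.span {axis S 1 | S. card S = m} \<subseteq> extpow m"
    by (rule vec.span_minimal[OF _ extpow_subspace]) (auto simp: extpow_def axis_def)
qed

lemma dim_extpow: "vec.dim (extpow m :: 'n::finite ext set) = CARD('n) choose m"
proof -
  let ?A = "{axis S (1::complex) | S::'n set. card S = m}"
  have "?A \<subseteq> cart_basis" unfolding cart_basis_def by auto
  then have "vec.independent ?A"
    using vec.independent_mono[OF independent_cart_basis] by blast
  then have "vec.dim (extpow m :: 'n ext set) = card ?A"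
    unfolding extpow_eq_span_axis by (rule vec.dim_span_eq_card_independent)
  also have "?A = (\<lambda>S. axis S 1) ` {S. card S = m}" by auto
  also have "card \<dots> = card {S::'n set. card S = m}"
    by (rule card_image) (auto simp: inj_on_def axis_eq_axis)
  also have "\<dots> = CARD('n) choose m"
    using n_subsets[of "UNIV :: 'n set" m] by simp
  finally show ?thesis .
qed

lemma length_basis_list:
  assumes "is_basis_list (b :: 'n::finite vsp list)"
  shows "length b = CARD('n)"
proof -
  have "distinct b" "vec.independent (set b)" "vec.span (set b) = UNIV"
    using assms unfolding is_basis_list_def by auto
  then show ?thesis
    using vec.dim_span_eq_card_independent[of "set b"] by (simp add: distinct_card card_cart_basis)
qed

definition basis_wedges :: "'n::{finite,linorder} vsp list \<Rightarrow> nat \<Rightarrow> 'n ext set" where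
  "basis_wedges b k = basis_wedge b ` {T. T \<subseteq> {..<length b} \<and> card T = k}"

lemma basis_wedgesE:
  assumes "x \<in> basis_wedges b k"
  obtains T where "T \<subseteq> {..<length b}" "card T = k" "x = basis_wedge b T"
  using assms unfolding basis_wedges_def by blast

lemma head_basis_wedge_in_basis_wedges:
  "k \<le> length b \<Longrightarrow> basis_wedge b {..<k} \<in> basis_wedges b k"
  unfolding basis_wedges_def by auto

lemma basis_wedges_subset_extpow: "basis_wedges b k \<subseteq> extpow k"
  unfolding basis_wedges_def
proof (rule image_subsetI)
  fix T assume "T \<in> {T. T \<subseteq> {..<length b} \<and> card T = k}"
  then show "basis_wedge b T \<in> extpow k"
    using wedge_in_extpow[of "map ((!) b) (sorted_list_of_set T)"] by (simp add: basis_wedge_def)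
qed

lemma set_eq_image_nth: "set xs = (!) xs ` {..<length xs}"
  by (auto simp: in_set_conv_nth)

lemma extpow_subset_span_basis_wedges:
  assumes b: "is_basis_list b"
  shows "extpow m \<subseteq> vec.span (basis_wedges b m)"
proof -
  let ?n = "length b"
  have "axis S 1 \<in> vec.span (basis_wedges b m)" if "card S = m" for S
  proof -
    have "vec.span ((!) b ` {..<?n}) = UNIV"
      using b set_eq_image_nth[of b] unfolding is_basis_list_def by simp
    then have "wedge (map (\<lambda>s. axis s 1) (sorted_list_of_set S))
        \<in> vec.span {basis_wedge b (\<phi> ` {..<m}) | \<phi>. \<phi> \<in> PiE {..<m} (\<lambda>_. {..<?n}) \<and> inj_on \<phi> {..<m}}"
      using that by (intro wedge_in_span_basis_wedges) auto
    also have "\<dots> \<subseteq> vec.span (basis_wedges b m)"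
      by (intro vec.span_mono) (force simp: basis_wedges_def card_image)
    finally show ?thesis by (simp only: wedge_axis)
  qed
  then show ?thesis
    unfolding extpow_eq_span_axis by (intro vec.span_minimal) auto
qed

lemma span_basis_wedges:
  assumes "is_basis_list b"
  shows "vec.span (basis_wedges b m) = extpow m"
  by (metis assms basis_wedges_subset_extpow extpow_subset_span_basis_wedges
      extpow_subspace vec.span_minimal subset_antisym)

lemma independent_basis_wedges:
  assumes b: "is_basis_list (b :: 'n::{finite,linorder} vsp list)"
  shows "vec.independent (basis_wedges b m)"
proof (rule vec.card_le_dim_spanning[OF basis_wedges_subset_extpow extpow_subset_span_basis_wedges[OF b]])
  show "finite (basis_wedges b m)" unfolding basis_wedges_def by simp
  have "card (basis_wedges b m) \<le> card {T. T \<subseteq> {..<length b} \<and> card T = m}"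
    unfolding basis_wedges_def by (rule card_image_le) simp
  also have "\<dots> = length b choose m" using n_subsets[of "{..<length b}" m] by simp
  also have "\<dots> = vec.dim (extpow m :: 'n ext set)" by (simp add: dim_extpow length_basis_list[OF b])
  finally show "card (basis_wedges b m) \<le> vec.dim (extpow m :: 'n ext set)" .
qed

lemma basis_wedge_neq_0:
  assumes "is_basis_list b" and "T \<subseteq> {..<length b}"
  shows "basis_wedge b T \<noteq> 0"
proof
  assume "basis_wedge b T = 0"
  then have "0 \<in> basis_wedges b (card T)" using assms(2) unfolding basis_wedges_def by force
  then show False using independent_basis_wedges[OF assms(1)] vec.dependent_zero by blast
qed

section \<open>Maps concentrated on the head monomial\<close>

lemma wedge_take_proportional:
  assumes B': "is_basis_list B'" and k: "k \<le> length B" "k \<le> length B'"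
    and head: "set (take k B') \<subseteq> vec.span (set (take k B))"
  shows "\<exists>\<mu>. \<mu> \<noteq> 0 \<and> wedge (take k B') = \<mu> *s wedge (take k B)"
proof -
  let ?u = "take k B"
  have "take k B' ! i \<in> vec.span ((!) ?u ` {..<k})" if "i < k" for i
  proof -
    have "take k B' ! i \<in> set (take k B')" by (rule nth_mem) (use that k in simp)
    then show ?thesis using head set_eq_image_nth[of ?u] k by auto
  qed
  then have "wedge (take k B')
      \<in> vec.span {basis_wedge ?u (\<phi> ` {..<k}) | \<phi>. \<phi> \<in> PiE {..<k} (\<lambda>_. {..<k}) \<and> inj_on \<phi> {..<k}}"
    using k by (intro wedge_in_span_basis_wedges) auto
  also have "\<dots> \<subseteq> vec.span {wedge ?u}"
  proof -
    have "basis_wedge ?u (\<phi> ` {..<k}) = wedge ?u"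
      if "\<phi> \<in> PiE {..<k} (\<lambda>_. {..<k})" "inj_on \<phi> {..<k}" for \<phi>
    proof -
      have "\<phi> ` {..<k} = {..<k}"
        using that by (intro card_subset_eq) (auto simp: card_image)
      then show ?thesis using k basis_wedge_lessThan[of k ?u] by simp
    qed
    then show ?thesis by (intro vec.span_mono) blast
  qed
  finally obtain \<mu> where \<mu>: "wedge (take k B') = \<mu> *s wedge ?u"
    by (auto simp: vec.span_singleton)
  moreover have "wedge (take k B') \<noteq> 0"
    using basis_wedge_neq_0[OF B', of "{..<k}"] basis_wedge_lessThan[of k B'] k by simp
  ultimately show ?thesis by auto
qed

definition head_monomial_map ::
    "nat \<Rightarrow> 'n::{finite,linorder} vsp list \<Rightarrow> 'n vsp list \<Rightarrow> ('n ext \<Rightarrow> 'n ext) \<Rightarrow> bool" where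
  "head_monomial_map k b B L \<longleftrightarrow>
     (\<forall>T. T \<subseteq> {..<length b} \<and> card T = k \<longrightarrow>
        L (basis_wedge b T) = (if T = {..<k} then wedge (take k B) else 0))"

lemma head_monomial_mapD:
  "head_monomial_map k b B L \<Longrightarrow> T \<subseteq> {..<length b} \<Longrightarrow> card T = k \<Longrightarrow>
    L (basis_wedge b T) = (if T = {..<k} then wedge (take k B) else 0)"
  unfolding head_monomial_map_def by blast

lemma head_monomial_map_image:
  assumes b: "is_basis_list b" and k: "k \<le> length b"
    and L: "Vector_Spaces.linear (*s) (*s) L" and hm: "head_monomial_map k b B L"
  shows "L ` extpow k = vec.span {wedge (take k B)}"
proof -
  have "L ` basis_wedges b k \<subseteq> {0, wedge (take k B)}"
  proof (rule image_subsetI, erule basis_wedgesE)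
    fix x T assume "T \<subseteq> {..<length b}" "card T = k" "x = basis_wedge b T"
    then show "L x \<in> {0, wedge (take k B)}"
      using head_monomial_mapD[OF hm] by simp
  qed
  then have "vec.span (L ` basis_wedges b k) \<subseteq> vec.span {0, wedge (take k B)}"
    by (rule vec.span_mono)
  moreover have "L (basis_wedge b {..<k}) = wedge (take k B)"
    using head_monomial_mapD[OF hm, of "{..<k}"] k by simp
  then have "wedge (take k B) \<in> L ` basis_wedges b k"
    using head_basis_wedge_in_basis_wedges[OF k] by (metis image_eqI)
  then have "vec.span {wedge (take k B)} \<subseteq> vec.span (L ` basis_wedges b k)"
    by (intro vec.span_mono) simp
  ultimately have "vec.span (L ` basis_wedges b k) = vec.span {wedge (take k B)}"
    by auto
  then show ?thesis
    using vec.linear_span_image[OF L, of "basis_wedges b k"] span_basis_wedges[OF b] by simp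
qed

lemma head_monomial_map_rank:
  fixes b B :: "'n::{finite,linorder} vsp list"
  assumes b: "is_basis_list b" and B: "is_basis_list B" and k: "k \<le> CARD('n)"
    and L: "Vector_Spaces.linear (*s) (*s) L" and hm: "head_monomial_map k b B L"
  shows "deg_rank k L = 1"
proof -
  have "wedge (take k B) \<noteq> 0"
    using basis_wedge_neq_0[OF B, of "{..<k}"] basis_wedge_lessThan[of k B] k length_basis_list[OF B]
    by simp
  then show ?thesis
    using head_monomial_map_image[OF b _ L hm] k length_basis_list[OF b]
    by (simp add: deg_rank_def vec.dim_span_eq_card_independent)
qed

lemma set_drop_eq_image_nth: "set (drop k xs) = (!) xs ` {k..<length xs}"
proof -
  have "drop k xs = drop k (map ((!) xs) [0..<length xs])"
    by (simp add: map_nth)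
  also have "\<dots> = map ((!) xs) [k..<length xs]"
    by (simp add: drop_map)
  finally show ?thesis by simp
qed

lemma head_monomial_map_vanishes:
  assumes b': "is_basis_list b'" and L': "Vector_Spaces.linear (*s) (*s) L'"
    and hm': "head_monomial_map k b' B' L'"
    and tail: "set (drop k b) \<subseteq> vec.span (set (drop k b'))"
    and T: "T \<subseteq> {..<length b}" "card T = k" "T \<noteq> {..<k}"
  shows "L' (basis_wedge b T) = 0"
proof -
  \<comment> \<open>\<open>T\<close> contains an index \<open>x \<ge> k\<close>; expanding \<open>b ! x\<close> in the tail of \<open>b'\<close> makes every
     resulting monomial of \<open>b'\<close> contain an index outside the head \<open>{..<k}\<close>.\<close>
  let ?n' = "length b'" and ?t = "sorted_list_of_set T"
  have "finite T" using T(1) finite_subset by blast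
  have "\<not> T \<subseteq> {..<k}"
    using T card_subset_eq[of "{..<k}" T] by auto
  then obtain x where "x \<in> T" "k \<le> x" by (meson lessThan_iff not_less subsetI)
  then obtain i0 where i0: "i0 < k" "?t ! i0 = x"
    using \<open>finite T\<close> T(2) by (metis in_set_conv_nth length_sorted_list_of_set set_sorted_list_of_set)
  define J where "J i = (if i = i0 then {k..<?n'} else {..<?n'})" for i
  have "b ! x \<in> set (drop k b)"
    using \<open>x \<in> T\<close> \<open>k \<le> x\<close> T(1) by (auto simp: set_drop_eq_image_nth)
  then have head_entry: "b ! x \<in> vec.span ((!) b' ` {k..<?n'})"
    using tail by (auto simp: set_drop_eq_image_nth)
  have "vec.span ((!) b' ` {..<?n'}) = UNIV"
    using b' set_eq_image_nth[of b'] unfolding is_basis_list_def by simp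
  then have "map ((!) b) ?t ! i \<in> vec.span ((!) b' ` J i)" if "i < k" for i
    using that i0 head_entry T(2) by (auto simp: J_def)
  then have expand: "basis_wedge b T
      \<in> vec.span {basis_wedge b' (\<phi> ` {..<k}) | \<phi>. \<phi> \<in> PiE {..<k} J \<and> inj_on \<phi> {..<k}}"
    unfolding basis_wedge_def[of b T] using T(2)
    by (intro wedge_in_span_basis_wedges) (auto simp: J_def)
  have killed: "L' (basis_wedge b' (\<phi> ` {..<k})) = 0"
    if \<phi>: "\<phi> \<in> PiE {..<k} J" "inj_on \<phi> {..<k}" for \<phi>
  proof -
    have sub: "\<phi> ` {..<k} \<subseteq> {..<?n'}"
      using PiE_mem[OF \<phi>(1)] by (fastforce simp: J_def split: if_splits)
    have card: "card (\<phi> ` {..<k}) = k"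
      using \<phi>(2) by (simp add: card_image)
    have "\<phi> i0 \<in> \<phi> ` {..<k}" "k \<le> \<phi> i0"
      using PiE_mem[OF \<phi>(1), of i0] i0(1) by (auto simp: J_def)
    then have "\<phi> ` {..<k} \<noteq> {..<k}" by (metis lessThan_iff not_less)
    then show ?thesis using head_monomial_mapD[OF hm' sub card] by simp
  qed
  show ?thesis
    using expand by (rule vec.linear_eq_0_on_span[OF L', rotated]) (auto intro: killed)
qed

lemma head_monomial_map_other_head:
  fixes b b' B' :: "'n::{finite,linorder} vsp list"
  assumes b: "is_basis_list b" and b': "is_basis_list b'" and B': "is_basis_list B'"
    and k: "k \<le> CARD('n)" and L': "Vector_Spaces.linear (*s) (*s) L'"
    and hm': "head_monomial_map k b' B' L'"
    and tail: "set (drop k b) \<subseteq> vec.span (set (drop k b'))"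
  shows "\<exists>d. d \<noteq> 0 \<and> L' (basis_wedge b {..<k}) = d *s wedge (take k B')"
proof -
  have lens: "length b = CARD('n)" "length b' = CARD('n)" "length B' = CARD('n)"
    using b b' B' by (simp_all add: length_basis_list)
  let ?W' = "wedge (take k B')" and ?h = "basis_wedge b {..<k}"
  have image': "L' ` extpow k = vec.span {?W'}"
    using head_monomial_map_image[OF b' _ L' hm'] k lens by simp
  have "?h \<in> extpow k"
    using head_basis_wedge_in_basis_wedges[of k b] basis_wedges_subset_extpow[of b k] k lens by auto
  then obtain d where d: "L' ?h = d *s ?W'"
    using image' by (auto simp: vec.span_singleton)
  have "d \<noteq> 0"
  proof
    assume "d = 0"
    have "L' s = 0" if s: "s \<in> basis_wedges b k" for s
    proof -
      obtain T where "T \<subseteq> {..<length b}" "card T = k" "s = basis_wedge b T"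
        using s by (rule basis_wedgesE)
      then show ?thesis
        using d \<open>d = 0\<close> head_monomial_map_vanishes[OF b' L' hm' tail] by (cases "T = {..<k}") auto
    qed
    then have "L' ` extpow k \<subseteq> {0}"
      using span_basis_wedges[OF b, of k] vec.linear_eq_0_on_span[OF L'] by blast
    moreover have "?W' \<noteq> 0"
      using basis_wedge_neq_0[OF B', of "{..<k}"] basis_wedge_lessThan[of k B'] k lens by simp
    ultimately show False
      using image' vec.span_superset[of "{?W'}"] by auto
  qed
  with d show ?thesis by blast
qed

lemma deg_eq_upto_if_eq_on_basis_wedges:
  assumes b: "is_basis_list b" and L: "Vector_Spaces.linear (*s) (*s) L"
    and L': "Vector_Spaces.linear (*s) (*s) L'" and "c \<noteq> 0"
    and eq: "\<And>s. s \<in> basis_wedges b k \<Longrightarrow> L s = c *s L' s"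
  shows "deg_eq_upto k L L'"
proof -
  have "\<forall>x\<in>extpow k. L x = c *s L' x"
    using vec.linear_eq_on[OF L vec.linear_compose_scale_right[OF L']] span_basis_wedges[OF b, of k] eq
    by blast
  with \<open>c \<noteq> 0\<close> show ?thesis unfolding deg_eq_upto_def by blast
qed

lemma head_monomial_map_eq_upto:
  fixes b B b' B' :: "'n::{finite,linorder} vsp list"
  assumes b: "is_basis_list b" and B: "is_basis_list B"
    and b': "is_basis_list b'" and B': "is_basis_list B'" and k: "k \<le> CARD('n)"
    and L: "Vector_Spaces.linear (*s) (*s) L" and hm: "head_monomial_map k b B L"
    and L': "Vector_Spaces.linear (*s) (*s) L'" and hm': "head_monomial_map k b' B' L'"
    and tail: "set (drop k b) \<subseteq> vec.span (set (drop k b'))"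
    and head: "set (take k B') \<subseteq> vec.span (set (take k B))"
  shows "deg_eq_upto k L L'"
proof -
  obtain \<mu> where "\<mu> \<noteq> 0" and \<mu>: "wedge (take k B') = \<mu> *s wedge (take k B)"
    using wedge_take_proportional[OF B' _ _ head] k length_basis_list[OF B] length_basis_list[OF B']
    by auto
  obtain d where "d \<noteq> 0" and d: "L' (basis_wedge b {..<k}) = d *s wedge (take k B')"
    using head_monomial_map_other_head[OF b b' B' k L' hm' tail] by blast
  define c where "c = inverse (d * \<mu>)"
  have "L s = c *s L' s" if s: "s \<in> basis_wedges b k" for s
  proof -
    obtain T where T: "T \<subseteq> {..<length b}" "card T = k" "s = basis_wedge b T"
      using s by (rule basis_wedgesE)
    show ?thesis
    proof (cases "T = {..<k}")
      case True
      then have "c *s L' s = (c * d * \<mu>) *s wedge (take k B)"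
        using d \<mu> T by (simp add: vec.scale_scale mult.assoc)
      also have "c * d * \<mu> = 1"
        using \<open>d \<noteq> 0\<close> \<open>\<mu> \<noteq> 0\<close> by (simp add: c_def field_simps)
      finally show ?thesis
        using head_monomial_mapD[OF hm T(1,2)] T True by simp
    next
      case False
      then show ?thesis
        using head_monomial_mapD[OF hm T(1,2)] head_monomial_map_vanishes[OF b' L' hm' tail T(1,2)] T(3)
        by simp
    qed
  qed
  moreover have "c \<noteq> 0" using \<open>d \<noteq> 0\<close> \<open>\<mu> \<noteq> 0\<close> by (simp add: c_def)
  ultimately show ?thesis
    using deg_eq_upto_if_eq_on_basis_wedges[OF b L L'] by blast
qed

section \<open>Linear relations spanned by adapted bases\<close>

definition rel_generators ::
    "'n::finite vsp list \<Rightarrow> 'n vsp list \<Rightarrow> 'n vsp list \<Rightarrow> 'n vsp list \<Rightarrow> ('n vsp \<times> 'n vsp) set" where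
  "rel_generators F g G h = Pair 0 ` set F \<union> set (zip g G) \<union> (\<lambda>v. (v, 0)) ` set h"

lemma linear_Pair_0: "Vector_Spaces.linear (*s) vpair.scale (Pair 0 :: 'n::finite vsp \<Rightarrow> 'n vsp \<times> 'n vsp)"
  unfolding Vector_Spaces.linear_iff
  by (simp add: vec.vector_space_axioms vpair.p.vector_space_axioms vpair.scale_prod)

lemma linear_swap: "Vector_Spaces.linear vpair.scale vpair.scale (prod.swap :: 'n::finite vsp \<times> 'n vsp \<Rightarrow> _)"
  unfolding Vector_Spaces.linear_iff
  by (simp add: vpair.p.vector_space_axioms vpair.scale_def)

lemma linear_snd_minus:
  assumes "Vector_Spaces.linear (*s) (*s) \<psi>"
  shows "Vector_Spaces.linear vpair.scale (*s) (\<lambda>z :: 'n::finite vsp \<times> 'n vsp. snd z - \<psi> (fst z))"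
  using assms unfolding Vector_Spaces.linear_iff
  by (simp add: vpair.p.vector_space_axioms vpair.scale_def vec.scale_right_diff_distrib algebra_simps)

lemma span_eq_between_insert_0: "A \<subseteq> B \<Longrightarrow> B \<subseteq> insert 0 A \<Longrightarrow> vec.span B = vec.span A"
  using vec.span_mono[of A B] vec.span_mono[of B "insert 0 A"] by auto

lemma swap_span_rel_generators:
  "prod.swap ` vpair.p.span (rel_generators F g G h) = vpair.p.span (rel_generators h G g F)"
proof -
  have "prod.swap ` set (zip g G) = set (zip G g)"
    by (simp add: zip_commute[of G g] prod.swap_def case_prod_unfold image_image)
  then have "prod.swap ` rel_generators F g G h = rel_generators h G g F"
    unfolding rel_generators_def by (auto simp: image_Un image_image)
  then show ?thesis
    using module_hom.span_image[OF linear_swap[unfolded module_hom_iff_linear[symmetric]],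
        of "rel_generators F g G h"] by simp
qed

lemma rKer_eq_rIndef_swap: "rKer P = rIndef (prod.swap ` P)"
  unfolding rKer_def rIndef_def by force

lemma rDom_eq_rIm_swap: "rDom P = rIm (prod.swap ` P)"
  unfolding rDom_def rIm_def by force

lemma rIm_span_rel_generators:
  assumes "length G = length g"
  shows "rIm (vpair.p.span (rel_generators F g G h)) = vec.span (set (F @ G))"
proof -
  have "snd ` set (zip g G) = set G"
    using assms by (metis map_snd_zip set_map)
  then have "snd ` rel_generators F g G h = set F \<union> set G \<union> (\<lambda>_. 0) ` set h"
    unfolding rel_generators_def by (simp add: image_Un image_image)
  then have "vec.span (snd ` rel_generators F g G h) = vec.span (set (F @ G))"
    by (intro span_eq_between_insert_0) auto
  moreover have "snd ` vpair.p.span (rel_generators F g G h) = vec.span (snd ` rel_generators F g G h)"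
    by (rule module_hom.span_image[OF vpair.linear_snd[unfolded module_hom_iff_linear[symmetric]], symmetric])
  ultimately show ?thesis
    unfolding rIm_def by simp
qed

lemma span_subset_rIndef_span_rel_generators:
  fixes F g G h :: "'n::finite vsp list"
  shows "vec.span (set F) \<subseteq> rIndef (vpair.p.span (rel_generators F g G h))"
proof -
  have "Pair (0 :: 'n vsp) ` vec.span (set F) = vpair.p.span (Pair 0 ` set F)"
    by (rule module_hom.span_image[OF linear_Pair_0[unfolded module_hom_iff_linear[symmetric]], symmetric])
  also have "\<dots> \<subseteq> vpair.p.span (rel_generators F g G h)"
    unfolding rel_generators_def by (intro vpair.p.span_mono) auto
  finally show ?thesis
    unfolding rIndef_def by (auto simp: image_subset_iff)
qed

lemma rIndef_span_rel_generators:
  fixes F g G h :: "'n::finite vsp list"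
  assumes indep: "vec.independent (set (g @ h))" and dist: "distinct (g @ h)"
    and len: "length G = length g"
  shows "rIndef (vpair.p.span (rel_generators F g G h)) = vec.span (set F)"
proof
  \<comment> \<open>\<open>\<psi>\<close> sends \<open>g ! j\<close> to \<open>G ! j\<close> and kills \<open>h\<close>, so \<open>z \<mapsto> snd z - \<psi> (fst z)\<close> maps every
     generator into the span of \<open>F\<close> and fixes the pairs \<open>(0, w)\<close>.\<close>
  define \<psi> where "\<psi> = vec.construct (set (g @ h))
    (\<lambda>v. if v \<in> set g then G ! inv_into {..<length g} ((!) g) v else 0)"
  let ?\<Phi> = "\<lambda>z. snd z - \<psi> (fst z)" and ?X = "rel_generators F g G h"
  have \<psi>: "Vector_Spaces.linear (*s) (*s) \<psi>"
    unfolding \<psi>_def by (rule vec.linear_construct[OF indep])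
  have \<psi>_basis: "\<psi> v = (if v \<in> set g then G ! inv_into {..<length g} ((!) g) v else 0)"
    if "v \<in> set (g @ h)" for v
    unfolding \<psi>_def by (rule vec.construct_basis[OF indep that])
  have "inj_on ((!) g) {..<length g}"
    using dist by (simp add: inj_on_nth)
  then have "\<psi> (g ! j) = G ! j" if "j < length g" for j
    using that \<psi>_basis[of "g ! j"] by simp
  moreover have "\<psi> v = 0" if "v \<in> set h" for v
    using that dist \<psi>_basis[of v] by auto
  ultimately have gens: "?\<Phi> ` ?X \<subseteq> insert 0 (set F)"
    using vec.linear_0[OF \<psi>] len unfolding rel_generators_def by (auto simp: set_zip)
  have "?\<Phi> ` vpair.p.span ?X = vec.span (?\<Phi> ` ?X)"
    by (rule module_hom.span_image[OF linear_snd_minus[OF \<psi>, unfolded module_hom_iff_linear[symmetric]], symmetric])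
  also have "\<dots> \<subseteq> vec.span (set F)"
    using vec.span_mono[OF gens] by simp
  finally have image: "?\<Phi> ` vpair.p.span ?X \<subseteq> vec.span (set F)" .
  show "rIndef (vpair.p.span ?X) \<subseteq> vec.span (set F)"
  proof
    fix w assume "w \<in> rIndef (vpair.p.span ?X)"
    then have "?\<Phi> (0, w) \<in> ?\<Phi> ` vpair.p.span ?X"
      unfolding rIndef_def by (intro imageI) simp
    then show "w \<in> vec.span (set F)"
      using image vec.linear_0[OF \<psi>] by auto
  qed
  show "vec.span (set F) \<subseteq> rIndef (vpair.p.span ?X)"
    by (rule span_subset_rIndef_span_rel_generators)
qed

lemma linrel_zero: "linrel P \<Longrightarrow> (0, 0) \<in> P"
  unfolding linrel_def using vpair.p.subspace_0 by (simp add: zero_prod_def)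

lemma rIndef_Times: "0 \<in> A \<Longrightarrow> rIndef (A \<times> B) = B"
  unfolding rIndef_def by auto

lemma rDom_Times: "0 \<in> B \<Longrightarrow> rDom (A \<times> B) = A"
  unfolding rDom_def by force

lemma rKer_Times: "0 \<in> B \<Longrightarrow> rKer (A \<times> B) = A"
  unfolding rKer_def by auto

lemma rIm_Times: "0 \<in> A \<Longrightarrow> rIm (A \<times> B) = B"
  unfolding rIm_def by force

section \<open>The operator lambda(P)\<close>

definition lambda_bases ::
    "'n::{finite,linorder} vsp list \<Rightarrow> 'n vsp list \<Rightarrow> 'n vsp list \<Rightarrow> 'n vsp list \<Rightarrow> 'n vsp list \<Rightarrow> 'n vsp list
     \<Rightarrow> ('n vsp \<times> 'n vsp) set \<Rightarrow> ('n ext \<Rightarrow> 'n ext) \<Rightarrow> bool" where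
  "lambda_bases f g h F G H P L \<longleftrightarrow>
     length F = length f \<and> length G = length g \<and> length H = length h \<and>
     is_basis_list (f @ g @ h) \<and> is_basis_list (F @ G @ H) \<and>
     P = vpair.p.span (rel_generators F g G h) \<and> Vector_Spaces.linear (*s) (*s) L \<and>
     (\<forall>T \<subseteq> {..<length (f @ g @ h)}. L (basis_wedge (f @ g @ h) T) =
        (if {..<length f} \<subseteq> T \<and> T \<subseteq> {..<length f + length g} then basis_wedge (F @ G @ H) T else 0))"

lemma is_lambda_iff_lambda_bases: "is_lambda P L \<longleftrightarrow> (\<exists>f g h F G H. lambda_bases f g h F G H P L)"
  unfolding is_lambda_def lambda_bases_def rel_generators_def basis_wedge_def by simp

lemma lambda_bases_subspaces:
  assumes "lambda_bases f g h F G H P L"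
  shows "rIndef P = vec.span (set F)" and "rIm P = vec.span (set (F @ G))"
    and "rDom P = vec.span (set (g @ h))" and "rKer P = vec.span (set h)"
proof -
  have len: "length G = length g" and P: "P = vpair.p.span (rel_generators F g G h)"
    and b: "is_basis_list (f @ g @ h)" and B: "is_basis_list (F @ G @ H)"
    using assms unfolding lambda_bases_def by auto
  have "vec.independent (set (g @ h))" "distinct (g @ h)"
    using b vec.independent_mono[of "set (f @ g @ h)" "set (g @ h)"] unfolding is_basis_list_def by auto
  then show "rIndef P = vec.span (set F)"
    unfolding P using len by (rule rIndef_span_rel_generators)
  show "rIm P = vec.span (set (F @ G))"
    unfolding P using len by (rule rIm_span_rel_generators)
  have "vec.independent (set (G @ F))" "distinct (G @ F)"
    using B vec.independent_mono[of "set (F @ G @ H)" "set (G @ F)"] unfolding is_basis_list_def by auto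
  then show "rKer P = vec.span (set h)"
    unfolding P rKer_eq_rIndef_swap swap_span_rel_generators using len[symmetric]
    by (rule rIndef_span_rel_generators)
  have "rDom P = vec.span (set (h @ g))"
    unfolding P rDom_eq_rIm_swap swap_span_rel_generators using len[symmetric]
    by (rule rIm_span_rel_generators)
  then show "rDom P = vec.span (set (g @ h))"
    by (simp add: Un_commute)
qed

lemma lambda_bases_dims:
  assumes "lambda_bases f g h F G H P L"
  shows "vec.dim (rIndef P) = length f" and "vec.dim (rIm P) = length f + length g"
proof -
  have "distinct (F @ G @ H)" and ind: "vec.independent (set (F @ G @ H))"
    and len: "length F = length f" "length G = length g"
    using assms unfolding lambda_bases_def is_basis_list_def by auto
  have "vec.independent (set F)" "vec.independent (set (F @ G))"
    using vec.independent_mono[OF ind, of "set F"] vec.independent_mono[OF ind, of "set (F @ G)"] by auto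
  moreover have "distinct (F @ G)" using \<open>distinct (F @ G @ H)\<close> by auto
  ultimately show "vec.dim (rIndef P) = length f" "vec.dim (rIm P) = length f + length g"
    using lambda_bases_subspaces[OF assms] len distinct_card[of "F @ G"] distinct_card[of F]
    by (simp_all add: vec.dim_eq_card_independent)
qed

lemma lambda_bases_head_monomial_map:
  assumes lb: "lambda_bases f g h F G H P L" and k: "k = length f \<or> k = length f + length g"
  shows "head_monomial_map k (f @ g @ h) (F @ G @ H) L"
  unfolding head_monomial_map_def
proof (intro allI impI, elim conjE)
  fix T assume T: "T \<subseteq> {..<length (f @ g @ h)}" "card T = k"
  then have "finite T" using finite_subset by blast
  have "{..<length f} \<subseteq> T \<and> T \<subseteq> {..<length f + length g} \<longleftrightarrow> T = {..<k}"
  proof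
    assume "{..<length f} \<subseteq> T \<and> T \<subseteq> {..<length f + length g}"
    then show "T = {..<k}"
      using k T(2) card_subset_eq[OF \<open>finite T\<close>, of "{..<length f}"] card_subset_eq[of "{..<length f + length g}" T]
      by auto
  qed (use k in auto)
  moreover have "basis_wedge (F @ G @ H) {..<k} = wedge (take k (F @ G @ H))"
    using lb k unfolding lambda_bases_def by (intro basis_wedge_lessThan) auto
  ultimately show "L (basis_wedge (f @ g @ h) T) = (if T = {..<k} then wedge (take k (F @ G @ H)) else 0)"
    using lb T(1) unfolding lambda_bases_def by auto
qed

lemma lambda_bases_vanishes_outside:
  assumes lb: "lambda_bases f g h F G H P L"
    and out: "\<not> (length f \<le> m \<and> m \<le> length f + length g)" and x: "x \<in> extpow m"
  shows "L x = 0"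
proof -
  have b: "is_basis_list (f @ g @ h)" and L: "Vector_Spaces.linear (*s) (*s) L"
    and LT: "\<And>T. T \<subseteq> {..<length (f @ g @ h)} \<Longrightarrow> L (basis_wedge (f @ g @ h) T) =
        (if {..<length f} \<subseteq> T \<and> T \<subseteq> {..<length f + length g} then basis_wedge (F @ G @ H) T else 0)"
    using lb unfolding lambda_bases_def by auto
  have "L s = 0" if s: "s \<in> basis_wedges (f @ g @ h) m" for s
  proof -
    obtain T where T: "T \<subseteq> {..<length (f @ g @ h)}" "card T = m" "s = basis_wedge (f @ g @ h) T"
      using s by (rule basis_wedgesE)
    then have "finite T" using finite_subset by blast
    have outside: "\<not> ({..<length f} \<subseteq> T \<and> T \<subseteq> {..<length f + length g})"
      using out T(2) card_mono[OF \<open>finite T\<close>, of "{..<length f}"] card_mono[of "{..<length f + length g}" T]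
      by auto
    show ?thesis
      unfolding T(3) LT[OF T(1)] if_not_P[OF outside] by (rule refl)
  qed
  then show "L x = 0"
    using x span_basis_wedges[OF b, of m] vec.linear_eq_0_on_span[OF L] by blast
qed

lemma lambda_bases_deg_nonzero_iff:
  assumes lb: "lambda_bases f g h F G H P L"
  shows "deg_nonzero m L \<longleftrightarrow> length f \<le> m \<and> m \<le> length f + length g"
proof
  assume "deg_nonzero m L"
  then show "length f \<le> m \<and> m \<le> length f + length g"
    using lambda_bases_vanishes_outside[OF lb] unfolding deg_nonzero_def by blast
next
  assume m: "length f \<le> m \<and> m \<le> length f + length g"
  have B: "is_basis_list (F @ G @ H)"
    and LT: "\<And>T. T \<subseteq> {..<length (f @ g @ h)} \<Longrightarrow> L (basis_wedge (f @ g @ h) T) =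
        (if {..<length f} \<subseteq> T \<and> T \<subseteq> {..<length f + length g} then basis_wedge (F @ G @ H) T else 0)"
    and len: "length F = length f" "length G = length g" "length H = length h"
    using lb unfolding lambda_bases_def by auto
  from m have "{..<m} \<subseteq> {..<length (f @ g @ h)}" by auto
  then have "L (basis_wedge (f @ g @ h) {..<m}) \<noteq> 0"
    using LT basis_wedge_neq_0[OF B, of "{..<m}"] m len by auto
  moreover have "basis_wedge (f @ g @ h) {..<m} \<in> extpow m"
    using head_basis_wedge_in_basis_wedges[of m "f @ g @ h"] basis_wedges_subset_extpow m by auto
  ultimately show "deg_nonzero m L" unfolding deg_nonzero_def by blast
qed

lemma lambda_bases_eq_upto:
  fixes f :: "'n::{finite,linorder} vsp list"
  assumes lb: "lambda_bases f g h F G H P L" and lb': "lambda_bases f' g' h' F' G' H' Q L'"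
    and k: "(k = length f \<and> k = length f') \<or> (k = length f + length g \<and> k = length f' + length g')"
    and tail: "set (drop k (f @ g @ h)) \<subseteq> vec.span (set (drop k (f' @ g' @ h')))"
    and head: "set (take k (F' @ G' @ H')) \<subseteq> vec.span (set (take k (F @ G @ H)))"
  shows "deg_eq_upto k L L'"
proof -
  have b: "is_basis_list (f @ g @ h)" and "is_basis_list (F @ G @ H)"
    "is_basis_list (f' @ g' @ h')" "is_basis_list (F' @ G' @ H')"
    "Vector_Spaces.linear (*s) (*s) L" "Vector_Spaces.linear (*s) (*s) L'"
    using lb lb' unfolding lambda_bases_def by auto
  moreover have "k \<le> CARD('n)"
    using k length_basis_list[OF b] by auto
  moreover have "head_monomial_map k (f @ g @ h) (F @ G @ H) L"
    "head_monomial_map k (f' @ g' @ h') (F' @ G' @ H') L'"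
    using k by (auto intro: lambda_bases_head_monomial_map[OF lb] lambda_bases_head_monomial_map[OF lb'])
  ultimately show ?thesis
    using head_monomial_map_eq_upto[OF _ _ _ _ _ _ _ _ _ tail head] by simp
qed

lemma is_lambda_deg_nonzero_iff:
  assumes "is_lambda P L"
  shows "deg_nonzero m L \<longleftrightarrow> vec.dim (rIndef P) \<le> m \<and> m \<le> vec.dim (rIm P)"
  using assms lambda_bases_deg_nonzero_iff lambda_bases_dims
  unfolding is_lambda_iff_lambda_bases by metis

lemma is_lambda_deg_rank:
  assumes lP: "is_lambda P (L :: 'n::{finite,linorder} ext \<Rightarrow> _)"
    and m: "m = vec.dim (rIndef P) \<or> m = vec.dim (rIm P)"
  shows "deg_rank m L = 1"
proof -
  obtain f g h F G H where lb: "lambda_bases f g h F G H P L"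
    using lP unfolding is_lambda_iff_lambda_bases by blast
  then have b: "is_basis_list (f @ g @ h)" and B: "is_basis_list (F @ G @ H)"
    and L: "Vector_Spaces.linear (*s) (*s) L"
    unfolding lambda_bases_def by auto
  have "m \<le> CARD('n)"
    using m lambda_bases_dims[OF lb] length_basis_list[OF b] by auto
  moreover have "head_monomial_map m (f @ g @ h) (F @ G @ H) L"
    using m lambda_bases_dims[OF lb] by (intro lambda_bases_head_monomial_map[OF lb]) auto
  ultimately show ?thesis
    by (rule head_monomial_map_rank[OF b B _ L])
qed

lemma is_lambda_eq_upto_Indef:
  assumes lP: "is_lambda P L" and lQ: "is_lambda Q L'"
    and Indef: "rIndef Q = rIndef P" and Dom: "rDom Q = rDom P"
  shows "deg_eq_upto (vec.dim (rIndef P)) L L'"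
proof -
  obtain f g h F G H where lb: "lambda_bases f g h F G H P L"
    using lP unfolding is_lambda_iff_lambda_bases by blast
  obtain f' g' h' F' G' H' where lb': "lambda_bases f' g' h' F' G' H' Q L'"
    using lQ unfolding is_lambda_iff_lambda_bases by blast
  let ?k = "length f"
  have k: "vec.dim (rIndef P) = ?k" "length f' = ?k"
    using lambda_bases_dims(1)[OF lb] lambda_bases_dims(1)[OF lb'] Indef by auto
  have "set (drop ?k (f @ g @ h)) \<subseteq> vec.span (set (g @ h))"
    by (simp add: vec.span_superset)
  also have "\<dots> = vec.span (set (drop ?k (f' @ g' @ h')))"
    using lambda_bases_subspaces(3)[OF lb] lambda_bases_subspaces(3)[OF lb'] Dom k(2) by simp
  finally have tail: "set (drop ?k (f @ g @ h)) \<subseteq> vec.span (set (drop ?k (f' @ g' @ h')))" .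
  have "length F = ?k" "length F' = ?k"
    using lb lb' k(2) unfolding lambda_bases_def by auto
  then have "set (take ?k (F' @ G' @ H')) \<subseteq> vec.span (set F')"
    by (simp add: vec.span_superset)
  also have "\<dots> = vec.span (set (take ?k (F @ G @ H)))"
    using lambda_bases_subspaces(1)[OF lb] lambda_bases_subspaces(1)[OF lb'] Indef \<open>length F = ?k\<close>
    by simp
  finally have head: "set (take ?k (F' @ G' @ H')) \<subseteq> vec.span (set (take ?k (F @ G @ H)))" .
  show ?thesis
    using lambda_bases_eq_upto[OF lb lb' _ tail head] k by simp
qed

lemma is_lambda_eq_upto_Im:
  assumes lP: "is_lambda P L" and lR: "is_lambda R L'"
    and Im: "rIm R = rIm P" and Ker: "rKer R = rKer P"
  shows "deg_eq_upto (vec.dim (rIm P)) L L'"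
proof -
  obtain f g h F G H where lb: "lambda_bases f g h F G H P L"
    using lP unfolding is_lambda_iff_lambda_bases by blast
  obtain f' g' h' F' G' H' where lb': "lambda_bases f' g' h' F' G' H' R L'"
    using lR unfolding is_lambda_iff_lambda_bases by blast
  let ?k = "length f + length g"
  have k: "vec.dim (rIm P) = ?k" "length f' + length g' = ?k"
    using lambda_bases_dims(2)[OF lb] lambda_bases_dims(2)[OF lb'] Im by auto
  have lens: "length F = length f" "length G = length g" "length F' = length f'" "length G' = length g'"
    using lb lb' unfolding lambda_bases_def by auto
  have "drop ?k (f' @ g' @ h') = h'" "take ?k (F' @ G' @ H') = F' @ G'"
    using lens by (simp_all flip: k(2))
  have "set (drop ?k (f @ g @ h)) \<subseteq> vec.span (set h)"
    by (simp add: vec.span_superset)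
  also have "\<dots> = vec.span (set (drop ?k (f' @ g' @ h')))"
    using lambda_bases_subspaces(4)[OF lb] lambda_bases_subspaces(4)[OF lb'] Ker
      \<open>drop ?k (f' @ g' @ h') = h'\<close> by simp
  finally have tail: "set (drop ?k (f @ g @ h)) \<subseteq> vec.span (set (drop ?k (f' @ g' @ h')))" .
  have "set (take ?k (F' @ G' @ H')) \<subseteq> vec.span (set (F' @ G'))"
    using \<open>take ?k (F' @ G' @ H') = F' @ G'\<close> by (simp add: vec.span_superset)
  also have "\<dots> = vec.span (set (take ?k (F @ G @ H)))"
    using lambda_bases_subspaces(2)[OF lb] lambda_bases_subspaces(2)[OF lb'] Im lens by simp
  finally have head: "set (take ?k (F' @ G' @ H')) \<subseteq> vec.span (set (take ?k (F @ G @ H)))" .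
  show ?thesis
    using lambda_bases_eq_upto[OF lb lb' _ tail head] k by simp
qed

theorem lemma1p3:
  fixes P :: "('n::{finite,linorder} vsp \<times> 'n vsp) set" and m :: nat
  assumes "linrel P" and "rdim P = CARD('n)"
  shows
   "(\<forall>L. is_lambda P L \<longrightarrow>
        (deg_nonzero m L \<longleftrightarrow> vec.dim (rIndef P) \<le> m \<and> m \<le> vec.dim (rIm P)))
    \<and>
    (m = vec.dim (rIndef P) \<longrightarrow>
        (\<forall>L. is_lambda P L \<longrightarrow> deg_rank m L = 1)
      \<and> (\<forall>Q. linrel Q \<and> rdim Q = CARD('n) \<and> rIndef Q = rIndef P \<and> rDom Q = rDom P \<longrightarrow>
            (\<forall>L L'. is_lambda P L \<and> is_lambda Q L' \<longrightarrow> deg_eq_upto m L L'))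
      \<and> (\<forall>L L'. is_lambda P L \<and> is_lambda (rDom P \<times> rIndef P) L' \<longrightarrow> deg_eq_upto m L L'))
    \<and>
    (m = vec.dim (rIm P) \<longrightarrow>
        (\<forall>L. is_lambda P L \<longrightarrow> deg_rank m L = 1)
      \<and> (\<forall>R. linrel R \<and> rdim R = CARD('n) \<and> rIm R = rIm P \<and> rKer R = rKer P \<longrightarrow>
            (\<forall>L L'. is_lambda P L \<and> is_lambda R L' \<longrightarrow> deg_eq_upto m L L'))
      \<and> (\<forall>L L'. is_lambda P L \<and> is_lambda (rKer P \<times> rIm P) L' \<longrightarrow> deg_eq_upto m L L'))"
proof -
  have "(0, 0) \<in> P" using assms(1) by (rule linrel_zero)
  then have "0 \<in> rDom P" "0 \<in> rIndef P" "0 \<in> rKer P" "0 \<in> rIm P"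
    unfolding rDom_def rIndef_def rKer_def rIm_def by force+
  then have products: "rIndef (rDom P \<times> rIndef P) = rIndef P" "rDom (rDom P \<times> rIndef P) = rDom P"
    "rKer (rKer P \<times> rIm P) = rKer P" "rIm (rKer P \<times> rIm P) = rIm P"
    by (simp_all add: rIndef_Times rDom_Times rKer_Times rIm_Times)
  show ?thesis
    using is_lambda_deg_nonzero_iff[of P]
      is_lambda_deg_rank[of P _ "vec.dim (rIndef P)"] is_lambda_deg_rank[of P _ "vec.dim (rIm P)"]
      is_lambda_eq_upto_Indef[of P] is_lambda_eq_upto_Im[of P] products
    by auto
qed

end
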